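(* For every odd integer $k\ge 3$, $C_4\not\le C_k$.
   Context: All graphs are finite and simple, considered up to isomorphism. An edge-colored graph is a pair $(G,c)$ with $c\colon E(G)\to\mathbb{N}$ an arbitrary map (not necessarily proper); it is colored in $t$ or more colors if $|c(E(G))|\ge t$. A subgraph (not necessarily induced) is rainbow if its edges receive pairwise distinct colors. $(G,c)$ is rainbow $H$-free if $G$ contains no rainbow subgraph isomorphic to $H$. For graphs $H_1,H_2$, write $H_1\le H_2$ if there is a positive integer $t$ such that every rainbow $H_1$-free edge-colored complete graph colored in $t$ or more colors is rainbow $H_2$-free. $C_k$ is the cycle on $k$ vertices. *)

theory Defs
  imports "HOL-Library.Ramsey"
begin

datatype 'a graph = Graph (verts: "'a set") (edges: "'a set set")

definition simple_graph :: "'a graph \<Rightarrow> bool" where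
  "simple_graph G \<longleftrightarrow> finite (verts G) \<and> edges G \<subseteq> nsets (verts G) 2"

definition complete_graph :: "'a set \<Rightarrow> 'a graph" where
  "complete_graph V = Graph V (nsets V 2)"

text \<open>A genuine cycle only for \<open>k \<ge> 3\<close>.\<close>
definition cycle_graph :: "nat \<Rightarrow> nat graph" where
  "cycle_graph k = Graph {..<k} {{i, Suc i mod k} | i. i < k}"

definition graph_iso :: "'a graph \<Rightarrow> 'b graph \<Rightarrow> bool" where
  "graph_iso G H \<longleftrightarrow>
     (\<exists>f. bij_betw f (verts G) (verts H) \<and> (\<lambda>e. f ` e) ` edges G = edges H)"

definition subgraph :: "'a graph \<Rightarrow> 'a graph \<Rightarrow> bool" where
  "subgraph F G \<longleftrightarrow> simple_graph F \<and> verts F \<subseteq> verts G \<and> edges F \<subseteq> edges G"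

text \<open>An edge colouring is a function on all sets of vertices; only its values on the
  edges of the graph at hand are ever used.\<close>
definition rainbow :: "('a set \<Rightarrow> nat) \<Rightarrow> 'a graph \<Rightarrow> bool" where
  "rainbow c F \<longleftrightarrow> inj_on c (edges F)"

definition rainbow_free :: "'b graph \<Rightarrow> 'a graph \<Rightarrow> ('a set \<Rightarrow> nat) \<Rightarrow> bool" where
  "rainbow_free H G c \<longleftrightarrow> \<not> (\<exists>F. subgraph F G \<and> rainbow c F \<and> graph_iso F H)"

text \<open>Every finite graph is isomorphic to one on natural numbers, so letting \<open>V\<close> range over the
  finite sets of naturals covers all finite complete graphs.\<close>
definition rainbow_le :: "'a graph \<Rightarrow> 'b graph \<Rightarrow> bool" (infix "\<preceq>\<^sub>r" 50) where
  "H1 \<preceq>\<^sub>r H2 \<longleftrightarrow>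
     (\<exists>t\<ge>1. \<forall>(V :: nat set) (c :: nat set \<Rightarrow> nat).
        finite V \<longrightarrow> t \<le> card (c ` edges (complete_graph V)) \<longrightarrow>
        rainbow_free H1 (complete_graph V) c \<longrightarrow> rainbow_free H2 (complete_graph V) c)"

end

theory Submission
  imports Defs
begin

text \<open>Colour the edge \<open>xy\<close> of the complete graph on \<open>{..<n}\<close> by \<open>0\<close> if \<open>x\<close> and \<open>y\<close> have the same
  parity, and by \<open>min x y + 1\<close> otherwise. A cycle has an even number of edges joining
  vertices of different parity, so an even cycle has an even number of edges of colour \<open>0\<close>; if it
  is rainbow it has none, but then the two edges at its least vertex share a colour. In contrast
  the odd cycle \<open>0, 1, \<dots>, k - 1\<close> has the colours \<open>1, \<dots>, k - 1, 0\<close>.\<close>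

definition parity_colour :: "nat set \<Rightarrow> nat" where
  "parity_colour e = (if even (Min e + Max e) then 0 else Suc (Min e))"

text \<open>The minimum and maximum of \<open>{x, y}\<close> add up to \<open>x + y\<close>; for
  \<open>x = y\<close> the sum is \<open>2 * x\<close>, so a degenerate pair gets colour 0.\<close>

lemma parity_colour_pair:
  "parity_colour {x, y} = (if even (x + y) then 0 else Suc (min x y))"
  by (cases x y rule: le_cases) (auto simp: parity_colour_def add.commute)

lemma parity_colour_4_cycle:
  "\<not> distinct (map parity_colour [{a, b}, {b, c}, {c, d}, {d, a}])"
proof
  assume distinct: "distinct (map parity_colour [{a, b}, {b, c}, {c, d}, {d, a}])"
  have zero: "parity_colour {x, y} = parity_colour {u, v}"
    if "even (x + y)" "even (u + v)" for x y u v
    using that by (simp add: parity_colour_pair)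
  \<comment> \<open>Each instance of \<open>zero\<close> forbids one pair of edges from both having
    an even sum. Exactly one even sum is impossible, since the four sums add up to an even
    number.\<close>
  have odd: "odd (a + b)" "odd (b + c)" "odd (c + d)" "odd (d + a)"
    using distinct zero[of a b b c] zero[of a b c d] zero[of a b d a]
      zero[of b c c d] zero[of b c d a] zero[of c d d a]
    by auto
  have same: "parity_colour {x, y} = parity_colour {x, z}"
    if "x \<le> y" "x \<le> z" "odd (x + y)" "odd (x + z)" for x y z
    using that by (simp add: parity_colour_pair min.absorb1)
  \<comment> \<open>A least vertex is at most both of its neighbours on the cycle, which is what
    \<open>same\<close> asks for.\<close>
  consider "a \<le> b" "a \<le> d" | "b \<le> a" "b \<le> c" | "c \<le> b" "c \<le> d" | "d \<le> a" "d \<le> c"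
    by linarith
  then show False
  proof cases
    case 1
    then show False using same[of a b d] odd distinct by (simp add: insert_commute)
  next
    case 2
    then show False using same[of b a c] odd distinct by (simp add: insert_commute)
  next
    case 3
    then show False using same[of c b d] odd distinct by (simp add: insert_commute)
  next
    case 4
    then show False using same[of d a c] odd distinct by (simp add: insert_commute)
  qed
qed

text \<open>Turns an isomorphism onto \<open>H\<close> into a labelling of the copy \<open>F\<close>
  by the vertices of \<open>H\<close>, so that a copy of a cycle can be walked along in
  order.\<close>

lemma graph_iso_inverse:
  assumes "graph_iso F H" "simple_graph F"
  obtains g where "inj_on g (verts H)"
    "\<And>x y. {x, y} \<in> edges H \<Longrightarrow> {g x, g y} \<in> edges F"
proof -
  obtain f where f: "bij_betw f (verts F) (verts H)" "(`) f ` edges F = edges H"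
    using assms(1) unfolding graph_iso_def by auto
  let ?g = "inv_into (verts F) f"
  have "{?g x, ?g y} \<in> edges F" if "{x, y} \<in> edges H" for x y
  proof -
    obtain e where e: "e \<in> edges F" "f ` e = {x, y}"
      using \<open>{x, y} \<in> edges H\<close> f(2) by (metis imageE)
    \<comment> \<open>The inverse undoes \<open>f\<close> only on \<open>verts F\<close>, so the
      edge has to lie inside it.\<close>
    then have "e \<subseteq> verts F"
      using assms(2) by (auto simp: simple_graph_def nsets_def)
    then have "e = ?g ` f ` e"
      using f(1) by (simp add: bij_betw_def)
    then show ?thesis
      using e by simp
  qed
  then show thesis
    using that f(1) by (metis bij_betw_def bij_betw_inv_into)
qed

lemma parity_colour_no_rainbow_C4: "rainbow_free (cycle_graph 4) G parity_colour"
  unfolding rainbow_free_def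
proof
  assume "\<exists>F. subgraph F G \<and> rainbow parity_colour F \<and> graph_iso F (cycle_graph 4)"
  then obtain F where F: "simple_graph F" "inj_on parity_colour (edges F)"
      "graph_iso F (cycle_graph 4)"
    by (auto simp: subgraph_def rainbow_def)
  obtain g where g: "inj_on g {..<4::nat}"
    "\<And>x y. {x, y} \<in> edges (cycle_graph 4) \<Longrightarrow> {g x, g y} \<in> edges F"
    using graph_iso_inverse[OF F(3,1)] by (auto simp: cycle_graph_def)
  have step: "{g i, g j} \<in> edges F" if "i < 4" "j = Suc i mod 4" for i j
    using that by (intro g(2)) (auto simp: cycle_graph_def)
  have edges: "{g 0, g 1} \<in> edges F" "{g 1, g 2} \<in> edges F"
    "{g 2, g 3} \<in> edges F" "{g 3, g 0} \<in> edges F"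
    by (rule step; simp)+
  \<comment> \<open>Rainbow separates the colours of different edges only, so the four edges must
    first be seen to be different sets.\<close>
  have distinct: "g 0 \<noteq> g 1" "g 0 \<noteq> g 2" "g 0 \<noteq> g 3" "g 1 \<noteq> g 2" "g 1 \<noteq> g 3" "g 2 \<noteq> g 3"
    by (simp_all add: inj_on_eq_iff[OF g(1)])
  have "distinct (map parity_colour [{g 0, g 1}, {g 1, g 2}, {g 2, g 3}, {g 3, g 0}])"
    using edges distinct by (simp add: inj_on_eq_iff[OF F(2)] doubleton_eq_iff)
  then show False
    using parity_colour_4_cycle by blast
qed

lemma parity_colour_path: "parity_colour {i, Suc i} = Suc i"
  by (simp add: parity_colour_pair)

lemma parity_colour_rainbow_cycle:
  assumes "odd k"
  shows "rainbow parity_colour (cycle_graph k)"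
proof -
  \<comment> \<open>The closing edge joins \<open>k - 1\<close> and 0, both even because
    \<open>k\<close> is odd, so its colour 0 fits the same formula as the other edges.\<close>
  have colour: "parity_colour {i, Suc i mod k} = Suc i mod k" if "i < k" for i
  proof (cases "Suc i = k")
    case True
    then have "Suc i mod k = 0" "even i"
      using assms by auto
    then show ?thesis
      by (simp only: parity_colour_pair) simp
  next
    case False
    then show ?thesis
      using that by (simp add: parity_colour_path)
  qed
  have inj: "i = j" if "i < k" "j < k" "Suc i mod k = Suc j mod k" for i j
    using that by (simp add: mod_Suc split: if_splits)
  show ?thesis
    unfolding rainbow_def
  proof (rule inj_onI)
    fix e e' assume "e \<in> edges (cycle_graph k)" "e' \<in> edges (cycle_graph k)"
      and eq: "parity_colour e = parity_colour e'"
    then obtain i j where ij: "i < k" "j < k" "e = {i, Suc i mod k}" "e' = {j, Suc j mod k}"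
      unfolding cycle_graph_def graph.sel by blast
    then have "Suc i mod k = Suc j mod k"
      using eq colour by metis
    then show "e = e'"
      using inj ij by metis
  qed
qed

text \<open>From \<open>k = 2\<close> on, \<open>i\<close> and \<open>Suc i mod k\<close> differ, so
  each edge has two elements; for \<open>k = 1\<close> the only edge would be
  \<open>{0}\<close>.\<close>

lemma cycle_subgraph_complete:
  assumes "2 \<le> k" "k \<le> n"
  shows "subgraph (cycle_graph k) (complete_graph {..<n})"
proof -
  have "edges (cycle_graph k) \<subseteq> nsets {..<k} 2"
    using assms(1) by (auto simp: cycle_graph_def nsets_def mod_Suc card_insert_if)
  moreover have "nsets {..<k} 2 \<subseteq> nsets {..<n} 2"
    using assms(2) by (intro nsets_mono) auto
  ultimately show ?thesis
    using assms(2) by (auto simp: subgraph_def simple_graph_def complete_graph_def cycle_graph_def)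
qed

lemma graph_iso_refl: "graph_iso G G"
  unfolding graph_iso_def by (intro exI[of _ id]) auto

text \<open>The edges of the path 0, 1, ..., \<open>n\<close> alone show the colours 1, ...,
  \<open>n\<close>, so any number of colours can be reached.\<close>

lemma parity_colour_card:
  "n \<le> card (parity_colour ` edges (complete_graph {..<Suc n}))"
proof -
  have "Suc ` {..<n} \<subseteq> parity_colour ` edges (complete_graph {..<Suc n})"
  proof
    fix x assume "x \<in> Suc ` {..<n}"
    then obtain i where "i < n" "x = parity_colour {i, Suc i}"
      by (auto simp: parity_colour_path)
    moreover have "{i, Suc i} \<in> edges (complete_graph {..<Suc n})"
      using \<open>i < n\<close> by (auto simp: complete_graph_def nsets_def)
    ultimately show "x \<in> parity_colour ` edges (complete_graph {..<Suc n})"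
      by blast
  qed
  moreover have "finite (edges (complete_graph {..<Suc n}))"
    by (simp add: complete_graph_def finite_imp_finite_nsets)
  ultimately show ?thesis
    using card_mono[of _ "Suc ` {..<n}"] by (fastforce simp: card_image)
qed

theorem theorem8:
  fixes k :: nat
  assumes "odd k" and "k \<ge> 3"
  shows "\<not> cycle_graph 4 \<preceq>\<^sub>r cycle_graph k"
proof
  assume "cycle_graph 4 \<preceq>\<^sub>r cycle_graph k"
  then obtain t where t: "\<And>(V :: nat set) c. finite V \<Longrightarrow>
      t \<le> card (c ` edges (complete_graph V)) \<Longrightarrow>
      rainbow_free (cycle_graph 4) (complete_graph V) c \<Longrightarrow>
      rainbow_free (cycle_graph k) (complete_graph V) c"
    unfolding rainbow_le_def by blast
  \<comment> \<open>Large enough both for \<open>t\<close> colours and for the vertices of the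
    \<open>k\<close>-cycle.\<close>
  let ?V = "{..<Suc (t + k)}"
  have "t \<le> card (parity_colour ` edges (complete_graph ?V))"
    using parity_colour_card[of "t + k"] by linarith
  then have "rainbow_free (cycle_graph k) (complete_graph ?V) parity_colour"
    by (intro t parity_colour_no_rainbow_C4) auto
  moreover have "subgraph (cycle_graph k) (complete_graph ?V)"
    using assms(2) by (intro cycle_subgraph_complete) auto
  ultimately show False
    using parity_colour_rainbow_cycle[OF assms(1)] graph_iso_refl
    unfolding rainbow_free_def by blast
qed

end
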